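(* For every $n\ge1$, on the semigroup $\mathcal{ODCT}_n$ the five Green's relations coincide: $\mathcal{L}=\mathcal{R}=\mathcal{D}=\mathcal{H}=\mathcal{J}$.
   Context: $[n]=\{1,2,\ldots,n\}$ with its usual order. Maps are written on the right of their arguments. $\mathcal{ODCT}_n$ is the semigroup (under composition, $x(\alpha\beta)=(x\alpha)\beta$) of all maps $\alpha:[n]\to[n]$ that are contractions ($|x\alpha-y\alpha|\le|x-y|$ for all $x,y\in[n]$), order-preserving ($x\le y\Rightarrow x\alpha\le y\alpha$) and order-decreasing ($x\alpha\le x$ for all $x\in[n]$). Green's relations on a semigroup $S$: $a\,\mathcal{L}\,b$ iff $S^1a=S^1b$; $a\,\mathcal{R}\,b$ iff $aS^1=bS^1$; $a\,\mathcal{J}\,b$ iff $S^1aS^1=S^1bS^1$; $\mathcal{H}=\mathcal{L}\cap\mathcal{R}$; $\mathcal{D}$ is the join of $\mathcal{L}$ and $\mathcal{R}$. *)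

theory Defs
  imports "HOL-Algebra.Group"
begin

text \<open>Green's relations use only the carrier and the multiplication of a structure.
  Here \<open>S\<^sup>1\<close> is never formed: \<open>S\<^sup>1a = {a} \<union> Sa\<close> and \<open>aS\<^sup>1 = {a} \<union> aS\<close>, whether or not an
  identity has to be adjoined, and \<open>S\<^sup>1aS\<^sup>1\<close> is \<open>(S\<^sup>1a)S\<^sup>1\<close>.\<close>

definition left_ideal_of :: "('a, 'b) monoid_scheme \<Rightarrow> 'a \<Rightarrow> 'a set" where
  "left_ideal_of S a = {a} \<union> {s \<otimes>\<^bsub>S\<^esub> a | s. s \<in> carrier S}"

definition right_ideal_of :: "('a, 'b) monoid_scheme \<Rightarrow> 'a \<Rightarrow> 'a set" where
  "right_ideal_of S a = {a} \<union> {a \<otimes>\<^bsub>S\<^esub> s | s. s \<in> carrier S}"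

definition two_sided_ideal_of :: "('a, 'b) monoid_scheme \<Rightarrow> 'a \<Rightarrow> 'a set" where
  "two_sided_ideal_of S a = (\<Union>b \<in> left_ideal_of S a. right_ideal_of S b)"

definition green_L :: "('a, 'b) monoid_scheme \<Rightarrow> 'a rel" where
  "green_L S = {(a, b) \<in> carrier S \<times> carrier S. left_ideal_of S a = left_ideal_of S b}"

definition green_R :: "('a, 'b) monoid_scheme \<Rightarrow> 'a rel" where
  "green_R S = {(a, b) \<in> carrier S \<times> carrier S. right_ideal_of S a = right_ideal_of S b}"

definition green_J :: "('a, 'b) monoid_scheme \<Rightarrow> 'a rel" where
  "green_J S =
     {(a, b) \<in> carrier S \<times> carrier S. two_sided_ideal_of S a = two_sided_ideal_of S b}"

definition green_H :: "('a, 'b) monoid_scheme \<Rightarrow> 'a rel" where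
  "green_H S = green_L S \<inter> green_R S"

text \<open>The join is taken in the lattice of equivalence relations on the carrier.\<close>

definition green_D :: "('a, 'b) monoid_scheme \<Rightarrow> 'a rel" where
  "green_D S = \<Inter> {E. equiv (carrier S) E \<and> green_L S \<union> green_R S \<subseteq> E}"

text \<open>Self-maps of \<open>{1..n}\<close> are extensional functions, so that equality of maps is
  equality of functions. Maps act on the right: the product \<open>\<alpha>\<beta>\<close> applies \<open>\<alpha>\<close> first.
  Distances are computed in \<^typ>\<open>int\<close> because subtraction on \<^typ>\<open>nat\<close> truncates.\<close>

definition ODCT :: "nat \<Rightarrow> (nat \<Rightarrow> nat) monoid" where
  "ODCT n =
     \<lparr>carrier = {\<alpha> \<in> {1..n} \<rightarrow>\<^sub>E {1..n}.
        (\<forall>x\<in>{1..n}. \<forall>y\<in>{1..n}. \<bar>int (\<alpha> x) - int (\<alpha> y)\<bar> \<le> \<bar>int x - int y\<bar>) \<and>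
        (\<forall>x\<in>{1..n}. \<forall>y\<in>{1..n}. x \<le> y \<longrightarrow> \<alpha> x \<le> \<alpha> y) \<and>
        (\<forall>x\<in>{1..n}. \<alpha> x \<le> x)},
      mult = (\<lambda>\<alpha> \<beta>. compose {1..n} \<beta> \<alpha>),
      one = (\<lambda>x\<in>{1..n}. x)\<rparr>"

lemma monoid_ODCT: "monoid (ODCT n)"
proof (rule monoidI)
  fix \<alpha> \<beta> assume a: "\<alpha> \<in> carrier (ODCT n)" and b: "\<beta> \<in> carrier (ODCT n)"
  have ma: "\<alpha> x \<in> {1..n}" if "x \<in> {1..n}" for x
    using a that by (auto simp: ODCT_def PiE_iff)
  have mb: "\<beta> x \<in> {1..n}" if "x \<in> {1..n}" for x
    using b that by (auto simp: ODCT_def PiE_iff)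
  have "compose {1..n} \<beta> \<alpha> \<in> {1..n} \<rightarrow>\<^sub>E {1..n}"
    using ma mb by (auto simp: PiE_iff compose_def)
  moreover have "\<bar>int (\<beta> (\<alpha> x)) - int (\<beta> (\<alpha> y))\<bar> \<le> \<bar>int x - int y\<bar>"
    if "x \<in> {1..n}" "y \<in> {1..n}" for x y
  proof -
    have "\<bar>int (\<beta> (\<alpha> x)) - int (\<beta> (\<alpha> y))\<bar> \<le> \<bar>int (\<alpha> x) - int (\<alpha> y)\<bar>"
      using b ma[OF that(1)] ma[OF that(2)] by (simp add: ODCT_def)
    also have "\<dots> \<le> \<bar>int x - int y\<bar>"
      using a that by (simp add: ODCT_def)
    finally show ?thesis .
  qed
  moreover have "\<beta> (\<alpha> x) \<le> \<beta> (\<alpha> y)" if "x \<in> {1..n}" "y \<in> {1..n}" "x \<le> y" for x y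
    using a b ma[OF that(1)] ma[OF that(2)] that by (simp add: ODCT_def)
  moreover have "\<beta> (\<alpha> x) \<le> x" if "x \<in> {1..n}" for x
  proof -
    have "\<beta> (\<alpha> x) \<le> \<alpha> x" using b ma[OF that] by (simp add: ODCT_def)
    also have "\<dots> \<le> x" using a that by (simp add: ODCT_def)
    finally show ?thesis .
  qed
  ultimately show "\<alpha> \<otimes>\<^bsub>ODCT n\<^esub> \<beta> \<in> carrier (ODCT n)"
    by (simp add: ODCT_def compose_eq)
next
  show "\<one>\<^bsub>ODCT n\<^esub> \<in> carrier (ODCT n)"
    by (auto simp: ODCT_def)
next
  fix \<alpha> \<beta> \<gamma>
  assume "\<alpha> \<in> carrier (ODCT n)"
  then have "\<alpha> \<in> {1..n} \<rightarrow> {1..n}" by (auto simp: ODCT_def PiE_def)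
  then show "\<alpha> \<otimes>\<^bsub>ODCT n\<^esub> \<beta> \<otimes>\<^bsub>ODCT n\<^esub> \<gamma> = \<alpha> \<otimes>\<^bsub>ODCT n\<^esub> (\<beta> \<otimes>\<^bsub>ODCT n\<^esub> \<gamma>)"
    by (simp add: ODCT_def compose_assoc)
next
  fix \<alpha> assume "\<alpha> \<in> carrier (ODCT n)"
  then show "\<one>\<^bsub>ODCT n\<^esub> \<otimes>\<^bsub>ODCT n\<^esub> \<alpha> = \<alpha>"
    by (auto simp: ODCT_def PiE_def compose_def fun_eq_iff extensional_def)
next
  fix \<alpha> assume "\<alpha> \<in> carrier (ODCT n)"
  then show "\<alpha> \<otimes>\<^bsub>ODCT n\<^esub> \<one>\<^bsub>ODCT n\<^esub> = \<alpha>"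
    by (auto simp: ODCT_def PiE_def Pi_def compose_def fun_eq_iff extensional_def)
qed

end

theory Submission
  imports Defs
begin

text \<open>The five relations coincide because each of them is equality. Say that \<open>a\<close> lies
  \<open>\<J>\<close>-below \<open>b\<close> if \<open>a = sbt\<close> with \<open>s, t \<in> S\<^sup>1\<close>. For order-preserving, order-decreasing maps this
  forces \<open>a \<le> b\<close> pointwise: precomposing with \<open>s\<close> lowers the argument of the monotone map \<open>b\<close>, and
  postcomposing with \<open>t\<close> lowers the value (\<open>ODCT_two_sided_ideal_le\<close>). So \<open>\<J>\<close>-related maps are
  equal. Once \<open>\<J>\<close> is equality, so are the other four relations, all of which lie between
  equality and \<open>\<J>\<close> (\<open>green_relations_trivial\<close>).\<close>

lemma left_ideal_of_self: "a \<in> left_ideal_of S a"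
  by (simp add: left_ideal_of_def)

lemma right_ideal_of_self: "a \<in> right_ideal_of S a"
  by (simp add: right_ideal_of_def)

lemma left_ideal_of_subset_two_sided: "left_ideal_of S a \<subseteq> two_sided_ideal_of S a"
  using right_ideal_of_self by (fastforce simp: two_sided_ideal_of_def)

lemma right_ideal_of_subset_two_sided: "right_ideal_of S a \<subseteq> two_sided_ideal_of S a"
  using left_ideal_of_self by (fastforce simp: two_sided_ideal_of_def)

text \<open>Elements that generate the same left, right or two-sided ideal lie in each other's two-sided
  ideal, so antisymmetry of the \<open>\<J>\<close>-order collapses \<open>\<L>\<close>, \<open>\<R>\<close> and \<open>\<J>\<close> at once.\<close>

lemma green_relations_trivial:
  fixes S :: "('a, 'b) monoid_scheme"
  assumes antisym: "\<And>a b. \<lbrakk>a \<in> carrier S; b \<in> carrier S;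
      a \<in> two_sided_ideal_of S b; b \<in> two_sided_ideal_of S a\<rbrakk> \<Longrightarrow> a = b"
  shows "green_L S = Id_on (carrier S)" "green_R S = Id_on (carrier S)"
    "green_D S = Id_on (carrier S)" "green_H S = Id_on (carrier S)"
    "green_J S = Id_on (carrier S)"
proof -
  have trivial: "{(a, b) \<in> carrier S \<times> carrier S. I a = I b} = Id_on (carrier S)"
    if "\<And>a. a \<in> I a" "\<And>a. I a \<subseteq> two_sided_ideal_of S a" for I :: "'a \<Rightarrow> 'a set"
    using antisym that by (auto simp: Id_on_iff) (metis subsetD)
  show L: "green_L S = Id_on (carrier S)"
    unfolding green_L_def
    by (intro trivial left_ideal_of_self left_ideal_of_subset_two_sided)
  show R: "green_R S = Id_on (carrier S)"
    unfolding green_R_def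
    by (intro trivial right_ideal_of_self right_ideal_of_subset_two_sided)
  show "green_J S = Id_on (carrier S)"
    unfolding green_J_def
    by (rule trivial) (use left_ideal_of_self left_ideal_of_subset_two_sided in fastforce)+
  show "green_H S = Id_on (carrier S)"
    by (simp add: green_H_def L R)
  \<comment> \<open>Equality is the least equivalence relation on the carrier, hence the join of itself with itself.\<close>
  have "equiv (carrier S) (Id_on (carrier S))"
    by (auto simp: equiv_def refl_on_def sym_def trans_def)
  then show "green_D S = Id_on (carrier S)"
    by (auto simp: green_D_def L R)
qed

text \<open>With \<open>\<gamma> = \<sigma>\<beta>\<close> and \<open>\<alpha> = \<gamma>\<tau>\<close>, the chain is \<open>x\<alpha> = (x\<gamma>)\<tau> \<le> x\<gamma> = (x\<sigma>)\<beta> \<le> x\<beta>\<close>: \<open>\<tau>\<close> is decreasing,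
  then \<open>\<sigma>\<close> is decreasing and \<open>\<beta>\<close> monotone.\<close>

lemma ODCT_two_sided_ideal_le:
  assumes b: "\<beta> \<in> carrier (ODCT n)"
    and a: "\<alpha> \<in> two_sided_ideal_of (ODCT n) \<beta>"
    and x: "x \<in> {1..n}"
  shows "\<alpha> x \<le> \<beta> x"
proof -
  obtain \<gamma> where g: "\<gamma> \<in> left_ideal_of (ODCT n) \<beta>" and ag: "\<alpha> \<in> right_ideal_of (ODCT n) \<gamma>"
    using a by (auto simp: two_sided_ideal_of_def)
  have "\<gamma> x \<in> {1..n} \<and> \<gamma> x \<le> \<beta> x"
  proof (cases "\<gamma> = \<beta>")
    case True
    then show ?thesis using b x by (auto simp: ODCT_def PiE_iff)
  next
    case False
    then obtain \<sigma> where s: "\<sigma> \<in> carrier (ODCT n)" and "\<gamma> = \<sigma> \<otimes>\<^bsub>ODCT n\<^esub> \<beta>"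
      using g by (auto simp: left_ideal_of_def)
    then have "\<gamma> x = \<beta> (\<sigma> x)" using x by (simp add: ODCT_def compose_eq)
    moreover have "\<sigma> x \<in> {1..n}" "\<sigma> x \<le> x" using s x by (auto simp: ODCT_def PiE_iff)
    ultimately show ?thesis using b x by (auto simp: ODCT_def PiE_iff)
  qed
  moreover have "\<alpha> x \<le> \<gamma> x" if "\<gamma> x \<in> {1..n}"
    using ag that x by (auto simp: right_ideal_of_def ODCT_def compose_eq)
  ultimately show ?thesis by linarith
qed

theorem corollary4:
  fixes n :: nat
  assumes "n \<ge> 1"
  shows "green_L (ODCT n) = green_R (ODCT n)
    \<and> green_R (ODCT n) = green_D (ODCT n)
    \<and> green_D (ODCT n) = green_H (ODCT n)
    \<and> green_H (ODCT n) = green_J (ODCT n)"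
proof -
  have J_antisym: "\<alpha> = \<beta>"
    if "\<alpha> \<in> carrier (ODCT n)" "\<beta> \<in> carrier (ODCT n)"
      "\<alpha> \<in> two_sided_ideal_of (ODCT n) \<beta>" "\<beta> \<in> two_sided_ideal_of (ODCT n) \<alpha>" for \<alpha> \<beta>
  proof (rule extensionalityI)
    show "\<alpha> \<in> extensional {1..n}" "\<beta> \<in> extensional {1..n}"
      using that by (auto simp: ODCT_def PiE_def)
    show "\<alpha> x = \<beta> x" if "x \<in> {1..n}" for x
      using ODCT_two_sided_ideal_le \<open>\<alpha> \<in> carrier _\<close> \<open>\<beta> \<in> carrier _\<close>
        \<open>\<alpha> \<in> two_sided_ideal_of _ _\<close> \<open>\<beta> \<in> two_sided_ideal_of _ _\<close> that
      by (metis order_antisym)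
  qed
  show ?thesis
    by (simp add: green_relations_trivial[of "ODCT n", OF J_antisym])
qed

end
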